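(* Let $\mathcal{S}\subset\mathbb{R}^d$ and let $x=x(s)\in\mathbb{R}^p$, $s\in\mathcal{S}$, be a parameterized $p$-vector (a measurable map $\mathcal{S}\to\mathbb{R}^p$ such that the entries of $x(s)x(s)^T$ are integrable over $\mathcal{S}$). Let $X$ be a real full rank matrix of size $p\times n$ with $n<p$ (not depending on $s$). Define the symmetric, positive semi-definite matrix $$C=\int_{\mathcal{S}} x(s)\,x(s)^T\,ds,$$ and let $C=U\Theta U^T$ be its eigenvalue decomposition, where $\theta_1\geq\cdots\geq\theta_p$ are the ordered eigenvalues (the diagonal entries of $\Theta$). Then $$\int_{\mathcal{S}} \min_{a\in\mathbb{R}^n}\|Xa-x(s)\|^2\,ds\;\geq\;\sqrt{\sum_{k=n+1}^p\theta_k^2}.$$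
   Context: $\|\cdot\|$ is the standard Euclidean norm, and $ds$ denotes integration with respect to Lebesgue measure on the measurable set $\mathcal{S}\subset\mathbb{R}^d$. *)

theory Defs
  imports "HOL-Analysis.Analysis"
begin

text \<open>The matrix \<open>v v\<^sup>T\<close>. The term \<open>columnvector v ** rowvector v\<close> would not do: the types of
  these constants leave the inner dimension free instead of making it 1, so it denotes
  a multiple of \<open>v v\<^sup>T\<close>.\<close>

definition outer_self :: "real^'p \<Rightarrow> real^'p^'p" where
  "outer_self v = (\<chi> i j. v $ i * v $ j)"

text \<open>Minima over an infinite set are written \<open>LEAST r. \<exists>a. r = f a\<close>. This is only meaningful when
  the minimum is attained, which the following fact ensures for linear least squares.\<close>

lemma least_squares_min_attained:
  fixes X :: "real^'n^'p" and y :: "real^'p"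
  shows "\<exists>a. \<forall>b. (norm (X *v a - y))\<^sup>2 \<le> (norm (X *v b - y))\<^sup>2"
proof -
  have "subspace (range ((*v) X))"
    by (simp add: linear_subspace_image)
  then have "closed (range ((*v) X))"
    by (rule closed_subspace)
  moreover have "range ((*v) X) \<noteq> {}" by simp
  ultimately obtain z where z: "z \<in> range ((*v) X)" "\<forall>w\<in>range ((*v) X). dist y z \<le> dist y w"
    by (rule distance_attains_inf) blast
  then obtain a where a: "z = X *v a" by blast
  have "norm (X *v a - y) \<le> norm (X *v b - y)" for b
    using z(2) a by (simp add: dist_norm norm_minus_commute)
  then show ?thesis
    by (meson norm_ge_zero power_mono)
qed

end

theory Submission
  imports Defs
begin

text \<open>For an orthonormal basis \<open>B\<close> of the column space of \<open>X\<close>, the pointwise minimum is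
  \<open>\<parallel>x\<parallel>\<^sup>2 - \<Sum>b\<in>B. (b \<bullet> x)\<^sup>2\<close>, so the integral is \<open>tr C - \<Sum>b\<in>B. b \<bullet> C b\<close>.
  By Ky Fan's maximum principle the subtracted sum is at most \<open>\<theta>\<^sub>1 + \<dots> + \<theta>\<^sub>n\<close>; hence the integral
  is at least \<open>\<theta>\<^sub>n\<^sub>+\<^sub>1 + \<dots> + \<theta>\<^sub>p\<close>, the \<open>\<ell>\<^sup>1\<close> norm of the nonnegative tail, which
  dominates its \<open>\<ell>\<^sup>2\<close> norm.\<close>

section \<open>Orthogonal projection and linear least squares\<close>

lemma norm_diff_orthonormal_projection:
  fixes u :: "'a::real_inner"
  assumes "finite B" "pairwise orthogonal B" "\<And>b. b \<in> B \<Longrightarrow> norm b = 1"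
  shows "(norm (u - (\<Sum>b\<in>B. (b \<bullet> u) *\<^sub>R b)))\<^sup>2 = (norm u)\<^sup>2 - (\<Sum>b\<in>B. (b \<bullet> u)\<^sup>2)"
proof -
  have "(norm (\<Sum>b\<in>B. (b \<bullet> u) *\<^sub>R b))\<^sup>2 = (\<Sum>b\<in>B. (norm ((b \<bullet> u) *\<^sub>R b))\<^sup>2)"
    using assms(1,2) by (intro norm_sum_Pythagorean) (auto simp: pairwise_def orthogonal_def)
  also have "\<dots> = (\<Sum>b\<in>B. (b \<bullet> u)\<^sup>2)"
    using assms(3) by (simp add: power_mult_distrib)
  finally have "(norm (\<Sum>b\<in>B. (b \<bullet> u) *\<^sub>R b))\<^sup>2 = (\<Sum>b\<in>B. (b \<bullet> u)\<^sup>2)" .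
  moreover have "u \<bullet> (\<Sum>b\<in>B. (b \<bullet> u) *\<^sub>R b) = (\<Sum>b\<in>B. (b \<bullet> u)\<^sup>2)"
    by (simp add: inner_sum_right power2_eq_square inner_commute)
  ultimately show ?thesis
    by (simp add: power2_norm_eq_inner inner_diff_left inner_diff_right inner_commute)
qed

lemma bessel_inequality_finite:
  fixes u :: "'a::real_inner"
  assumes "finite B" "pairwise orthogonal B" "\<And>b. b \<in> B \<Longrightarrow> norm b = 1"
  shows "(\<Sum>b\<in>B. (b \<bullet> u)\<^sup>2) \<le> (norm u)\<^sup>2"
  using norm_diff_orthonormal_projection[OF assms, of u]
  by (smt (verit) zero_le_power2)

text \<open>The residual of the projection \<open>P\<close> is orthogonal to all of
  \<open>span B\<close>, so Pythagoras splits \<open>z - u\<close> into \<open>z - P\<close> and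
  \<open>P - u\<close>; dropping the first part leaves the residual.\<close>

lemma norm_diff_span_orthonormal_ge:
  fixes u :: "'a::real_inner"
  assumes "finite B" "pairwise orthogonal B" "\<And>b. b \<in> B \<Longrightarrow> norm b = 1"
    and z: "z \<in> span B"
  shows "(norm u)\<^sup>2 - (\<Sum>b\<in>B. (b \<bullet> u)\<^sup>2) \<le> (norm (z - u))\<^sup>2"
proof -
  define P where "P = (\<Sum>b\<in>B. (b \<bullet> u) *\<^sub>R b)"
  have "P \<in> span B"
    unfolding P_def by (intro span_sum span_scale span_base)
  with z have "z - P \<in> span B" by (rule span_diff)
  moreover have "orthogonal (u - P) b" if "b \<in> B" for b
  proof -
    have "(\<Sum>c\<in>B. (c \<bullet> u) * (c \<bullet> b)) = (\<Sum>c\<in>B. if c = b then b \<bullet> u else 0)"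
      using assms(2) assms(3)[OF that] that
      by (intro sum.cong) (auto simp: pairwise_def orthogonal_def norm_eq_1)
    then show ?thesis
      using assms(1) that
      by (simp add: P_def orthogonal_def inner_diff_left inner_sum_left inner_commute[of u])
  qed
  ultimately have "orthogonal (u - P) (z - P)"
    by (metis orthogonal_to_span)
  then have "(norm (z - u))\<^sup>2 = (norm (z - P))\<^sup>2 + (norm (u - P))\<^sup>2"
    by (simp add: orthogonal_def power2_norm_eq_inner inner_diff_left inner_diff_right inner_commute
        algebra_simps)
  then show ?thesis
    using norm_diff_orthonormal_projection[OF assms(1-3), of u] by (simp add: P_def)
qed

text \<open>The projection of \<open>u\<close> lies in the column space, so the lower bound of
  \<open>norm_diff_span_orthonormal_ge\<close> is attained and \<open>LEAST\<close> denotes a true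
  minimum. This makes the integrand quadratic in \<open>u\<close>.\<close>

lemma Least_least_squares:
  fixes X :: "real^'n^'p" and u :: "real^'p"
  assumes "finite B" "pairwise orthogonal B" "\<And>b. b \<in> B \<Longrightarrow> norm b = 1"
    and span: "span B = range ((*v) X)"
  shows "(LEAST r. \<exists>a. r = (norm (X *v a - u))\<^sup>2) = (norm u)\<^sup>2 - (\<Sum>b\<in>B. (b \<bullet> u)\<^sup>2)"
proof (rule Least_equality)
  have "(\<Sum>b\<in>B. (b \<bullet> u) *\<^sub>R b) \<in> span B"
    by (intro span_sum span_scale span_base)
  then obtain a where "(\<Sum>b\<in>B. (b \<bullet> u) *\<^sub>R b) = X *v a"
    using span by auto
  then show "\<exists>a. (norm u)\<^sup>2 - (\<Sum>b\<in>B. (b \<bullet> u)\<^sup>2) = (norm (X *v a - u))\<^sup>2"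
    using norm_diff_orthonormal_projection[OF assms(1-3), of u] by (metis norm_minus_commute)
next
  fix r assume "\<exists>a. r = (norm (X *v a - u))\<^sup>2"
  then show "(norm u)\<^sup>2 - (\<Sum>b\<in>B. (b \<bullet> u)\<^sup>2) \<le> r"
    using norm_diff_span_orthonormal_ge[OF assms(1-3)] span by blast
qed

section \<open>Integrals of quadratic expressions in \<open>x\<close> via the matrix
  integral\<close>

lemma power2_inner_eq_outer_self:
  "(v \<bullet> y)\<^sup>2 = (\<Sum>i\<in>UNIV. \<Sum>j\<in>UNIV. v $ i * v $ j * outer_self y $ i $ j)"
  by (simp add: inner_vec_def power2_eq_square sum_product outer_self_def mult_ac)

text \<open>A matrix is the finite sum of its entries times the matrix units
  \<open>axis i (axis j 1)\<close>, so entrywise integrability carries over to the matrix-valued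
  Bochner integral.\<close>

lemma integrable_outer_self:
  fixes x :: "'a \<Rightarrow> real^'p"
  assumes "\<And>i j. integrable M (\<lambda>s. outer_self (x s) $ i $ j)"
  shows "integrable M (\<lambda>s. outer_self (x s))"
proof -
  have "integrable M (\<lambda>s. \<Sum>i\<in>UNIV. \<Sum>j\<in>UNIV. outer_self (x s) $ i $ j *\<^sub>R axis i (axis j (1::real)))"
    using assms by (intro Bochner_Integration.integrable_sum integrable_scaleR_left) auto
  \<comment> \<open>The outer \<open>axis i\<close> puts a condition free of \<open>j\<close> around
    each inner summand; pulling it out lets the double sum collapse to one entry.\<close>
  moreover have "(\<Sum>j\<in>UNIV. if P then f j else 0) = (if P then sum f UNIV else 0)"
    for P and f :: "'p \<Rightarrow> real"
    by simp
  then have "(\<Sum>i\<in>UNIV. \<Sum>j\<in>UNIV. A $ i $ j *\<^sub>R axis i (axis j (1::real))) = A" for A :: "real^'p^'p"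
    by (simp add: vec_eq_iff axis_def if_distrib[of "\<lambda>v. v $ _"] if_distrib[of "\<lambda>r. _ * r"] cong: if_cong)
  ultimately show ?thesis by simp
qed

lemma LINT_outer_self_component:
  fixes x :: "'a \<Rightarrow> real^'p"
  assumes "\<And>i j. integrable M (\<lambda>s. outer_self (x s) $ i $ j)"
  shows "(LINT s|M. outer_self (x s)) $ i $ j = (LINT s|M. outer_self (x s) $ i $ j)"
proof -
  have "bounded_linear (\<lambda>A :: real^'p^'p. A $ i $ j)"
    by (intro bounded_linear_compose[OF bounded_linear_vec_nth bounded_linear_vec_nth])
  from integral_bounded_linear[OF this integrable_outer_self[OF assms]]
  show ?thesis by simp
qed

text \<open>The square expands into a linear combination of entries of
  \<open>outer_self (x s)\<close>, which integrate separately. It serves both for the projection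
  coefficients and for the sign of the eigenvalues.\<close>

lemma has_bochner_integral_power2_inner:
  fixes x :: "'a \<Rightarrow> real^'p"
  assumes "\<And>i j. integrable M (\<lambda>s. outer_self (x s) $ i $ j)"
  shows "has_bochner_integral M (\<lambda>s. (v \<bullet> x s)\<^sup>2) (v \<bullet> ((LINT s|M. outer_self (x s)) *v v))"
proof -
  have "v \<bullet> ((LINT s|M. outer_self (x s)) *v v) =
      (\<Sum>i\<in>UNIV. \<Sum>j\<in>UNIV. v $ i * v $ j * (LINT s|M. outer_self (x s) $ i $ j))"
    by (simp add: inner_vec_def matrix_vector_mult_def sum_distrib_left
        LINT_outer_self_component[OF assms] mult_ac)
  then show ?thesis
    unfolding power2_inner_eq_outer_self
    by (auto intro!: has_bochner_integral_sum has_bochner_integral_mult_right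
        has_bochner_integral_integrable assms)
qed

lemma has_bochner_integral_power2_norm:
  fixes x :: "'a \<Rightarrow> real^'p"
  assumes "\<And>i j. integrable M (\<lambda>s. outer_self (x s) $ i $ j)"
  shows "has_bochner_integral M (\<lambda>s. (norm (x s))\<^sup>2) (trace (LINT s|M. outer_self (x s)))"
proof -
  have "(norm y)\<^sup>2 = (\<Sum>i\<in>UNIV. outer_self y $ i $ i)" for y :: "real^'p"
    by (simp add: power2_norm_eq_inner inner_vec_def outer_self_def)
  then show ?thesis
    unfolding trace_def LINT_outer_self_component[OF assms]
    by (auto intro!: has_bochner_integral_sum has_bochner_integral_integrable assms)
qed

section \<open>Spectral coordinates and the extremal bound for weighted eigenvalue sums\<close>

lemma inner_diagonalized_mult:
  fixes U \<Theta> :: "real^'p^'p"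
  assumes "\<And>i j. i \<noteq> j \<Longrightarrow> \<Theta> $ i $ j = 0"
  shows "v \<bullet> ((U ** \<Theta> ** transpose U) *v v) = (\<Sum>i\<in>UNIV. \<Theta> $ i $ i * (v \<bullet> column i U)\<^sup>2)"
proof -
  \<comment> \<open>The inner products of \<open>v\<close> with the columns of \<open>U\<close>; in
    terms of these the quadratic form is diagonal.\<close>
  define w where "w = transpose U *v v"
  have w: "w $ i = v \<bullet> column i U" for i
    by (simp add: w_def matrix_vector_mult_def transpose_def column_def inner_vec_def mult.commute)
  have "(\<Sum>j\<in>UNIV. \<Theta> $ i $ j * w $ j) = (\<Sum>j\<in>UNIV. if j = i then \<Theta> $ i $ i * w $ i else 0)" for i
    using assms by (intro sum.cong) auto
  then have d: "(\<Theta> *v w) $ i = \<Theta> $ i $ i * w $ i" for i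
    by (simp add: matrix_vector_mult_def)
  have "v \<bullet> ((U ** \<Theta> ** transpose U) *v v) = w \<bullet> (\<Theta> *v w)"
    by (simp add: w_def dot_lmul_matrix flip: matrix_vector_mul_assoc)
  also have "\<dots> = (\<Sum>i\<in>UNIV. \<Theta> $ i $ i * (w $ i)\<^sup>2)"
    by (simp add: inner_vec_def d power2_eq_square mult_ac)
  finally show ?thesis by (simp add: w)
qed

text \<open>The extremal part of Ky Fan's principle: \<open>w\<close> is compared with the indicator
  \<open>e\<close> of the first \<open>n\<close> indices. As \<open>w k\<close> lies between 0 and
  1, \<open>w k - e k\<close> is nonpositive up to \<open>n\<close> and nonnegative beyond, opposite
  to the sign of \<open>\<theta> k - \<theta> n\<close>.\<close>

lemma sum_weighted_le_sum_first:
  fixes \<theta> w :: "nat \<Rightarrow> real"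
  assumes "1 \<le> n" "n \<le> p"
    and anti: "\<And>k l. 1 \<le> k \<Longrightarrow> k \<le> l \<Longrightarrow> l \<le> p \<Longrightarrow> \<theta> l \<le> \<theta> k"
    and w: "\<And>k. k \<in> {1..p} \<Longrightarrow> 0 \<le> w k" "\<And>k. k \<in> {1..p} \<Longrightarrow> w k \<le> 1"
    and sum_w: "(\<Sum>k = 1..p. w k) = real n"
  shows "(\<Sum>k = 1..p. \<theta> k * w k) \<le> (\<Sum>k = 1..n. \<theta> k)"
proof -
  define e where "e k = (if k \<le> n then 1 else 0 :: real)" for k
  have "{1..p} \<inter> {k. k \<le> n} = {1..n}"
    using assms(2) by auto
  then have e: "(\<Sum>k = 1..p. e k) = n" "(\<Sum>k = 1..p. \<theta> k * e k) = (\<Sum>k = 1..n. \<theta> k)"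
    by (simp_all add: e_def if_distrib sum.If_cases del: One_nat_def cong: if_cong)
  \<comment> \<open>Since \<open>w\<close> and \<open>e\<close> have the same sum, \<open>\<theta>\<close> may be shifted by the constant \<open>\<theta> n\<close>.\<close>
  have "(\<theta> k - \<theta> n) * (w k - e k) \<le> 0" if "k \<in> {1..p}" for k
    using that w[OF that] anti[of k n] anti[of n k] assms(1,2)
    by (cases "k \<le> n") (auto simp: e_def mult_le_0_iff)
  then have "(\<Sum>k = 1..p. (\<theta> k - \<theta> n) * (w k - e k)) \<le> 0"
    by (intro sum_nonpos)
  also have "(\<Sum>k = 1..p. (\<theta> k - \<theta> n) * (w k - e k)) =
      ((\<Sum>k = 1..p. \<theta> k * w k) - (\<Sum>k = 1..p. \<theta> k * e k))
        - \<theta> n * ((\<Sum>k = 1..p. w k) - (\<Sum>k = 1..p. e k))"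
    by (simp add: algebra_simps sum.distrib sum_subtractf sum_distrib_left)
  finally show ?thesis by (simp add: sum_w e del: One_nat_def)
qed

lemma norm_column_orthogonal_matrix:
  fixes U :: "real^'p^'p"
  assumes "orthogonal_matrix U"
  shows "norm (column i U) = 1"
  using assms by (simp add: orthogonal_matrix_orthonormal_columns)

lemma sum_power2_inner_column_orthogonal_matrix:
  fixes U :: "real^'p^'p"
  assumes "orthogonal_matrix U"
  shows "(\<Sum>i\<in>UNIV. (v \<bullet> column i U)\<^sup>2) = (norm v)\<^sup>2"
proof -
  \<comment> \<open>Parseval's identity is the diagonalization formula with all eigenvalues equal to
    1.\<close>
  have "v \<bullet> ((U ** mat 1 ** transpose U) *v v) = (\<Sum>i\<in>UNIV. (v \<bullet> column i U)\<^sup>2)"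
    by (subst inner_diagonalized_mult) (auto simp: mat_def)
  then show ?thesis
    using assms by (simp add: orthogonal_matrix_def power2_norm_eq_inner)
qed

theorem theorem4p1:
  fixes S :: "(real^'d) set"
    and x :: "real^'d \<Rightarrow> real^'p"
    and X :: "real^'n^'p"
    and C U \<Theta> :: "real^'p^'p"
    and \<theta> :: "nat \<Rightarrow> real"
    and idx :: "nat \<Rightarrow> 'p"
  assumes "S \<in> sets lebesgue"
    and "x \<in> borel_measurable (lebesgue_on S)"
    and "\<And>i j. integrable (lebesgue_on S) (\<lambda>s. outer_self (x s) $ i $ j)"
    and "CARD('n) < CARD('p)"
    and "rank X = CARD('n)"
    and "C = (LINT s|lebesgue_on S. outer_self (x s))"
    and "orthogonal_matrix U"
    and "\<And>i j. i \<noteq> j \<Longrightarrow> \<Theta> $ i $ j = 0"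
    and "C = U ** \<Theta> ** transpose U"
    and "bij_betw idx {1..CARD('p)} UNIV"
    and "\<And>k. k \<in> {1..CARD('p)} \<Longrightarrow> \<theta> k = \<Theta> $ idx k $ idx k"
    and "\<And>k l. 1 \<le> k \<Longrightarrow> k \<le> l \<Longrightarrow> l \<le> CARD('p) \<Longrightarrow> \<theta> l \<le> \<theta> k"
  shows "(LINT s|lebesgue_on S. (LEAST r. \<exists>a. r = (norm (X *v a - x s))\<^sup>2))
           \<ge> sqrt (\<Sum>k = CARD('n) + 1..CARD('p). (\<theta> k)\<^sup>2)"
proof -
  let ?M = "lebesgue_on S" and ?n = "CARD('n)" and ?p = "CARD('p)"
  \<comment> \<open>Since \<open>f\<close> sees both the eigenvalue and its matrix index, this one
    reindexing serves the trace, the quadratic forms and the weights.\<close>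
  have \<theta>_idx: "(\<Sum>k = 1..?p. f (\<theta> k) (idx k)) = (\<Sum>i\<in>UNIV. f (\<Theta> $ i $ i) i)"
    for f :: "real \<Rightarrow> 'p \<Rightarrow> real"
    unfolding sum.reindex_bij_betw[OF assms(10), symmetric]
    by (intro sum.cong) (simp_all only: assms(11))
  have quad: "has_bochner_integral ?M (\<lambda>s. (v \<bullet> x s)\<^sup>2) (v \<bullet> (C *v v))" for v
    unfolding assms(6) by (rule has_bochner_integral_power2_inner) (rule assms(3))
  have diag: "v \<bullet> (C *v v) = (\<Sum>i\<in>UNIV. \<Theta> $ i $ i * (v \<bullet> column i U)\<^sup>2)" for v
    unfolding assms(9) by (rule inner_diagonalized_mult) (rule assms(8))
  have eig: "v \<bullet> (C *v v) = (\<Sum>k = 1..?p. \<theta> k * (v \<bullet> column (idx k) U)\<^sup>2)" for v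
    unfolding diag
    by (rule \<theta>_idx[of "\<lambda>t i. t * (v \<bullet> column i U)\<^sup>2", symmetric])
  have "trace C = trace (transpose U ** (U ** \<Theta>))"
    unfolding assms(9) by (rule trace_mul_sym)
  also have "\<dots> = trace \<Theta>"
    using assms(7) by (simp add: matrix_mul_assoc orthogonal_matrix_def)
  finally have trace: "trace C = (\<Sum>k = 1..?p. \<theta> k)"
    using \<theta>_idx[of "\<lambda>t i. t"] by (simp add: trace_def)
  \<comment> \<open>The quadratic form of \<open>C\<close> at a unit eigenvector \<open>?u\<close>
    is its eigenvalue, and it is also the integral of the square
    \<open>(?u \<bullet> x s)\<^sup>2\<close>.\<close>
  have \<theta>_nonneg: "0 \<le> \<theta> k" if k: "k \<in> {1..?p}" for k
  proof -
    let ?u = "column (idx k) U"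
    have "?u \<bullet> column j U = (if j = idx k then 1 else 0)" for j
      using assms(7)
      by (auto simp: orthogonal_matrix_orthonormal_columns orthogonal_def norm_eq_1)
    then have "?u \<bullet> (C *v ?u) = \<Theta> $ idx k $ idx k"
      unfolding diag
      by (simp add: if_distrib[of "\<lambda>r. r\<^sup>2"] if_distrib[of "\<lambda>r. _ * r"] cong: if_cong)
    moreover have "0 \<le> ?u \<bullet> (C *v ?u)"
      unfolding has_bochner_integral_integral_eq[OF quad, symmetric]
      by (rule integral_nonneg_AE) simp
    ultimately show ?thesis using assms(11)[OF k] by simp
  qed
  have "subspace (range ((*v) X))"
    by (simp add: linear_subspace_image)
  then obtain B where B: "pairwise orthogonal B" "\<And>b. b \<in> B \<Longrightarrow> norm b = 1" "independent B"
    "card B = dim (range ((*v) X))" "span B = range ((*v) X)"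
    by (rule orthonormal_basis_subspace) blast
  have fin: "finite B" and card: "card B = ?n"
    using B assms(5) by (auto simp: independent_imp_finite rank_dim_range)
  \<comment> \<open>The squared length of the projection of the \<open>k\<close>-th eigenvector onto
    the column space of \<open>X\<close>: at most 1 by Bessel, and with total \<open>card B\<close>
    by Parseval applied to each \<open>b\<close>.\<close>
  define w where "w k = (\<Sum>b\<in>B. (b \<bullet> column (idx k) U)\<^sup>2)" for k
  have "(\<Sum>b\<in>B. b \<bullet> (C *v b)) = (\<Sum>k = 1..?p. \<theta> k * w k)"
    unfolding eig w_def sum_distrib_left by (rule sum.swap)
  also have "\<dots> \<le> (\<Sum>k = 1..?n. \<theta> k)"
  proof (rule sum_weighted_le_sum_first)
    show "w k \<le> 1" for k
      using bessel_inequality_finite[OF fin B(1,2), of "column (idx k) U"]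
      by (simp add: w_def norm_column_orthogonal_matrix[OF assms(7)])
    have "(\<Sum>k = 1..?p. w k) = (\<Sum>b\<in>B. \<Sum>i\<in>UNIV. (b \<bullet> column i U)\<^sup>2)"
      unfolding w_def sum.swap[of _ B] \<theta>_idx[of "\<lambda>t i. (_ \<bullet> column i U)\<^sup>2"] ..
    also have "\<dots> = ?n"
      using B(2) card by (simp add: sum_power2_inner_column_orthogonal_matrix[OF assms(7)])
    finally show "(\<Sum>k = 1..?p. w k) = real ?n" .
  qed (use assms(4,12) in \<open>auto simp: w_def sum_nonneg Suc_le_eq\<close>)
  finally have fan: "(\<Sum>b\<in>B. b \<bullet> (C *v b)) \<le> (\<Sum>k = 1..?n. \<theta> k)" .
  have least: "(LEAST r. \<exists>a. r = (norm (X *v a - u))\<^sup>2) = (norm u)\<^sup>2 - (\<Sum>b\<in>B. (b \<bullet> u)\<^sup>2)" for u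
    using fin B(1,2,5) by (rule Least_least_squares)
  have "has_bochner_integral ?M (\<lambda>s. (norm (x s))\<^sup>2 - (\<Sum>b\<in>B. (b \<bullet> x s)\<^sup>2))
      (trace C - (\<Sum>b\<in>B. b \<bullet> (C *v b)))"
    unfolding assms(6)
    by (intro has_bochner_integral_diff has_bochner_integral_sum
        has_bochner_integral_power2_norm has_bochner_integral_power2_inner assms(3))
  then have int: "(LINT s|?M. (LEAST r. \<exists>a. r = (norm (X *v a - x s))\<^sup>2)) =
      trace C - (\<Sum>b\<in>B. b \<bullet> (C *v b))"
    unfolding least by (rule has_bochner_integral_integral_eq)
  have "{1..?p} = {1..?n} \<union> {?n + 1..?p}" "{1..?n} \<inter> {?n + 1..?p} = {}"
    using assms(4) by auto
  then have split: "(\<Sum>k = 1..?p. \<theta> k) = (\<Sum>k = 1..?n. \<theta> k) + (\<Sum>k = ?n + 1..?p. \<theta> k)"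
    by (simp add: sum.union_disjoint)
  \<comment> \<open>Positive semidefiniteness of \<open>C\<close> enters here: a tail with negative
    entries could sum to less than its Euclidean length.\<close>
  have "sqrt (\<Sum>k = ?n + 1..?p. (\<theta> k)\<^sup>2) \<le> (\<Sum>k = ?n + 1..?p. \<theta> k)"
    using L2_set_le_sum[of "{?n + 1..?p}" \<theta>] \<theta>_nonneg by (simp add: L2_set_def)
  then show ?thesis
    using int trace fan split by linarith
qed

end
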